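(* Let $1<p<\infty$, $1\leq q<\infty$, $p\neq q$, and let $T\colon\ell_p\to\ell_q$ be a bounded linear operator that is not identically zero and that attains its norm (i.e. there exists $v\in\ell_p$ with $\|v\|_{\ell_p}=1$ and $\|T(v)\|_{\ell_q}=\|T\|$). Then every not weakly null maximizing sequence for $T$ has a norm-convergent subsequence in $\ell_p$.
   Context: Here $\ell_p$ denotes the usual Banach space of $p$-summable scalar sequences indexed by $\mathbb{N}$, and $\|T\|=\sup\{\|T(x)\|_{\ell_q}:\|x\|_{\ell_p}=1\}$. A not weakly null maximizing sequence for $T\colon\ell_p\to\ell_q$ is a sequence $(u^n)_{n\ge 1}$ in $\ell_p$ such that $\|u^n\|_{\ell_p}=1$ for all $n$, $\|T(u^n)\|_{\ell_q}\to\|T\|$ as $n\to\infty$, and $(u^n)$ does not converge weakly to $0$ in $\ell_p$. *)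

theory Defs
  imports "HOL-Analysis.Analysis"
begin

text \<open>
  The scalar field is a type \<open>'a :: {real_normed_field, heine_borel}\<close>. Both \<^typ>\<open>real\<close> and
  \<^typ>\<open>complex\<close> are instances, and up to isometric isomorphism there are no others
  (Gelfand--Mazur). Linearity always refers to \<open>'a\<close>.

  As the exponent is a real parameter, \<open>\<ell>\<^sub>p\<close> is a carrier set of sequences, not a type, and all
  notions are relativised to it; the values of operators and functionals outside the carrier
  are irrelevant. The definitions are meant for exponents \<open>p \<ge> 1\<close>.
\<close>

definition lp_space :: "real \<Rightarrow> (nat \<Rightarrow> 'a::{real_normed_field, heine_borel}) set" where
  "lp_space p = {x. summable (\<lambda>i. norm (x i) powr p)}"

definition lp_norm :: "real \<Rightarrow> (nat \<Rightarrow> 'a::{real_normed_field, heine_borel}) \<Rightarrow> real" where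
  "lp_norm p x = (\<Sum>i. norm (x i) powr p) powr (1 / p)"

definition lp_bounded_linear_operator ::
    "real \<Rightarrow> real \<Rightarrow> ((nat \<Rightarrow> 'a::{real_normed_field, heine_borel}) \<Rightarrow> (nat \<Rightarrow> 'a)) \<Rightarrow> bool" where
  "lp_bounded_linear_operator p q T \<longleftrightarrow>
     (\<forall>x\<in>lp_space p. T x \<in> lp_space q) \<and>
     (\<forall>x\<in>lp_space p. \<forall>y\<in>lp_space p. T (\<lambda>i. x i + y i) = (\<lambda>i. T x i + T y i)) \<and>
     (\<forall>c. \<forall>x\<in>lp_space p. T (\<lambda>i. c * x i) = (\<lambda>i. c * T x i)) \<and>
     (\<exists>C. \<forall>x\<in>lp_space p. lp_norm q (T x) \<le> C * lp_norm p x)"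

definition lp_operator_norm ::
    "real \<Rightarrow> real \<Rightarrow> ((nat \<Rightarrow> 'a::{real_normed_field, heine_borel}) \<Rightarrow> (nat \<Rightarrow> 'a)) \<Rightarrow> real" where
  "lp_operator_norm p q T = (SUP x\<in>{x \<in> lp_space p. lp_norm p x = 1}. lp_norm q (T x))"

definition lp_attains_norm ::
    "real \<Rightarrow> real \<Rightarrow> ((nat \<Rightarrow> 'a::{real_normed_field, heine_borel}) \<Rightarrow> (nat \<Rightarrow> 'a)) \<Rightarrow> bool" where
  "lp_attains_norm p q T \<longleftrightarrow>
     (\<exists>v\<in>lp_space p. lp_norm p v = 1 \<and> lp_norm q (T v) = lp_operator_norm p q T)"

definition lp_bounded_linear_functional ::
    "real \<Rightarrow> ((nat \<Rightarrow> 'a::{real_normed_field, heine_borel}) \<Rightarrow> 'a) \<Rightarrow> bool" where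
  "lp_bounded_linear_functional p f \<longleftrightarrow>
     (\<forall>x\<in>lp_space p. \<forall>y\<in>lp_space p. f (\<lambda>i. x i + y i) = f x + f y) \<and>
     (\<forall>c. \<forall>x\<in>lp_space p. f (\<lambda>i. c * x i) = c * f x) \<and>
     (\<exists>C. \<forall>x\<in>lp_space p. norm (f x) \<le> C * lp_norm p x)"

definition lp_converges_weakly ::
    "real \<Rightarrow> (nat \<Rightarrow> nat \<Rightarrow> 'a::{real_normed_field, heine_borel}) \<Rightarrow> (nat \<Rightarrow> 'a) \<Rightarrow> bool" where
  "lp_converges_weakly p u l \<longleftrightarrow>
     (\<forall>f. lp_bounded_linear_functional p f \<longrightarrow> (\<lambda>n. f (u n)) \<longlonglongrightarrow> f l)"

definition lp_converges_in_norm ::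
    "real \<Rightarrow> (nat \<Rightarrow> nat \<Rightarrow> 'a::{real_normed_field, heine_borel}) \<Rightarrow> (nat \<Rightarrow> 'a) \<Rightarrow> bool" where
  "lp_converges_in_norm p u l \<longleftrightarrow> (\<lambda>n. lp_norm p (\<lambda>i. u n i - l i)) \<longlonglongrightarrow> 0"

definition not_weakly_null_maximizing_sequence ::
    "real \<Rightarrow> real \<Rightarrow> ((nat \<Rightarrow> 'a::{real_normed_field, heine_borel}) \<Rightarrow> (nat \<Rightarrow> 'a))
      \<Rightarrow> (nat \<Rightarrow> nat \<Rightarrow> 'a) \<Rightarrow> bool" where
  "not_weakly_null_maximizing_sequence p q T u \<longleftrightarrow>
     (\<forall>n. u n \<in> lp_space p \<and> lp_norm p (u n) = 1) \<and>
     (\<lambda>n. lp_norm q (T (u n))) \<longlonglongrightarrow> lp_operator_norm p q T \<and>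
     \<not> lp_converges_weakly p u (\<lambda>_. 0)"

end

theory Submission
  imports Defs
begin

text \<open>
  Pass to a subsequence on which a functional witnessing the failure of weak convergence stays
  away from \<open>0\<close> and which converges coordinatewise, to \<open>x\<close> say. Bounded coordinatewise null
  sequences are weakly null as \<open>p > 1\<close>, so \<open>x \<noteq> 0\<close>. Put \<open>w\<^sub>n = u\<^sub>n - x\<close> and
  \<open>a = \<parallel>x\<parallel>\<^sup>p\<close>. The Brezis--Lieb splitting
  \<open>\<parallel>y + z\<^sub>n\<parallel>\<^sup>p - \<parallel>z\<^sub>n\<parallel>\<^sup>p \<longlonglongrightarrow> \<parallel>y\<parallel>\<^sup>p\<close> for bounded coordinatewise null \<open>z\<^sub>n\<close>, used in both
  spaces, gives \<open>\<parallel>w\<^sub>n\<parallel>\<^sup>p \<longlonglongrightarrow> 1 - a\<close> and \<open>\<parallel>T w\<^sub>n\<parallel>\<^sup>q \<longlonglongrightarrow> \<parallel>T\<parallel>\<^sup>q - \<parallel>T x\<parallel>\<^sup>q\<close>. It remains to see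
  that \<open>a = 1\<close>. If \<open>q > p\<close>, the second limit yields \<open>1 \<le> a powr (q / p) + (1 - a) powr (q / p)\<close>,
  which fails for \<open>0 < a < 1\<close>. If \<open>q < p\<close>, then \<open>\<parallel>T w\<^sub>n\<parallel> \<longlonglongrightarrow> 0\<close> (Pitt), whence
  \<open>\<parallel>T x\<parallel> = \<parallel>T\<parallel>\<close>.
\<close>

section \<open>Norm and modular of a sequence\<close>

text \<open>The \<open>p\<close>-th power of the norm on \<open>lp_space p\<close> when
  \<open>p > 0\<close>; this quantity, not the norm, splits additively.\<close>

definition lp_modular :: "real \<Rightarrow> (nat \<Rightarrow> 'a::{real_normed_field, heine_borel}) \<Rightarrow> real" where
  "lp_modular p x = (\<Sum>i. norm (x i) powr p)"

lemma lp_spaceD: "x \<in> lp_space p \<Longrightarrow> summable (\<lambda>i. norm (x i) powr p)"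
  by (simp add: lp_space_def)

lemma lp_modular_nonneg: "x \<in> lp_space p \<Longrightarrow> 0 \<le> lp_modular p x"
  unfolding lp_modular_def by (intro suminf_nonneg) (auto dest: lp_spaceD)

lemma lp_norm_modular: "lp_norm p x = lp_modular p x powr (1 / p)"
  by (simp add: lp_norm_def lp_modular_def)

lemma lp_norm_nonneg: "0 \<le> lp_norm p x"
  by (simp add: lp_norm_def)

lemma lp_modular_eq_norm_powr:
  assumes "x \<in> lp_space p" "0 < p"
  shows "lp_modular p x = lp_norm p x powr p"
  using assms lp_modular_nonneg[OF assms(1)] by (simp add: lp_norm_modular powr_powr)

lemma lp_norm_eq_1_iff:
  assumes "x \<in> lp_space p" "0 < p"
  shows "lp_norm p x = 1 \<longleftrightarrow> lp_modular p x = 1"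
  using lp_modular_eq_norm_powr[OF assms] by (auto simp: lp_norm_modular)

lemma norm_powr_le_lp_modular:
  assumes "x \<in> lp_space p"
  shows "norm (x i) powr p \<le> lp_modular p x"
  using sum_le_suminf[OF lp_spaceD[OF assms], of "{i}"] by (simp add: lp_modular_def)

lemma norm_le_lp_norm:
  assumes "x \<in> lp_space p" "0 < p"
  shows "norm (x i) \<le> lp_norm p x"
  using powr_mono2[of "1/p", OF _ _ norm_powr_le_lp_modular[OF assms(1), of i]] assms(2)
  by (simp add: lp_norm_modular powr_powr)

lemma lp_space_scale: "x \<in> lp_space p \<Longrightarrow> (\<lambda>i. c * x i) \<in> lp_space p"
  by (auto simp: lp_space_def norm_mult powr_mult intro: summable_mult)

lemma lp_modular_scale:
  "x \<in> lp_space p \<Longrightarrow> lp_modular p (\<lambda>i. c * x i) = norm c powr p * lp_modular p x"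
  by (simp add: lp_space_def lp_modular_def norm_mult powr_mult suminf_mult)

lemma lp_norm_scale:
  assumes "x \<in> lp_space p" "0 < p"
  shows "lp_norm p (\<lambda>i. c * x i) = norm c * lp_norm p x"
  using assms by (simp add: lp_norm_modular lp_modular_scale powr_mult powr_powr)

section \<open>Pointwise inequalities and the Brezis-Lieb splitting\<close>

text \<open>Convexity of the \<open>p\<close>-th power: \<open>norm b + norm a\<close> is the mean
  of \<open>norm b / (1 - l)\<close> and \<open>norm a / l\<close> with weights \<open>1 - l\<close>
  and \<open>l\<close>.\<close>

lemma norm_add_powr_le:
  fixes a b :: "'a::real_normed_vector"
  assumes "1 \<le> p" "0 < l" "l < 1"
  shows "norm (a + b) powr p \<le> (1 - l) powr (1 - p) * norm b powr p + l powr (1 - p) * norm a powr p"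
proof -
  have *: "c * (r / c) powr p = c powr (1 - p) * r powr p" if "0 < c" "0 \<le> r" for c r :: real
    using that by (simp add: powr_divide powr_diff)
  have conv: "convex_on {0..} (\<lambda>x::real. x powr p)"
  proof (rule convex_onI)
    fix t x y :: real
    assume t: "0 < t" "t < 1" and x: "x \<in> {0..}" and y: "y \<in> {0..}"
    \<comment> \<open>If one argument is \<open>0\<close>, convexity reduces to this bound on the
      weight of the other.\<close>
    have le: "c powr p \<le> c" if "0 \<le> c" "c \<le> 1" for c :: real
      using that powr_le_one_le[of c p] assms(1) by (cases "c = 0") auto
    consider "x = 0" | "y = 0" | "x > 0" "y > 0" using x y by fastforce
    then show "((1 - t) *\<^sub>R x + t *\<^sub>R y) powr p \<le> (1 - t) * x powr p + t * y powr p"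
    proof cases
      case 3
      then show ?thesis using convex_onD[OF powr_convex[OF assms(1)], of t x y] t by simp
    qed (use t x y le[of t] le[of "1 - t"] in \<open>auto simp: powr_mult intro!: mult_right_mono\<close>)
  qed simp
  have "norm (a + b) powr p \<le> (norm b + norm a) powr p"
    using norm_triangle_ineq[of a b] assms(1) by (intro powr_mono2) auto
  also have "norm b + norm a = (1 - l) *\<^sub>R (norm b / (1 - l)) + l *\<^sub>R (norm a / l)"
    using assms by simp
  also have "\<dots> powr p \<le> (1 - l) * (norm b / (1 - l)) powr p + l * (norm a / l) powr p"
    by (rule convex_onD[OF conv]) (use assms in auto)
  finally show ?thesis using assms by (simp add: *)
qed

text \<open>The factor \<open>(1 - l) powr (1 - p)\<close> tends to \<open>1\<close> as
  \<open>l\<close> decreases to \<open>0\<close>, so some \<open>l\<close> brings it below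
  \<open>1 + e\<close>.\<close>

lemma norm_add_powr_le_eps:
  assumes "1 \<le> p" "0 < e"
  obtains C where "0 \<le> C"
    "\<And>a b :: 'a::real_normed_vector. norm (a + b) powr p \<le> (1 + e) * norm b powr p + C * norm a powr p"
proof -
  have "((\<lambda>l::real. (1 - l) powr (1 - p)) \<longlongrightarrow> (1 - 0) powr (1 - p)) (at_right 0)"
    by (intro tendsto_intros) auto
  then have "eventually (\<lambda>l::real. (1 - l) powr (1 - p) < 1 + e) (at_right 0)"
    by (rule order_tendstoD) (use assms in simp)
  moreover have "eventually (\<lambda>l::real. 0 < l \<and> l < 1) (at_right 0)"
    by (auto simp: eventually_at_right_field intro: exI[of _ 1])
  ultimately have "eventually (\<lambda>l::real. (1 - l) powr (1 - p) < 1 + e \<and> 0 < l \<and> l < 1) (at_right 0)"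
    by eventually_elim simp
  then obtain l :: real where l: "(1 - l) powr (1 - p) < 1 + e" "0 < l" "l < 1"
    using eventually_happens by fastforce
  show ?thesis
  proof (rule that[of "l powr (1 - p)"])
    fix a b :: 'a
    show "norm (a + b) powr p \<le> (1 + e) * norm b powr p + l powr (1 - p) * norm a powr p"
      using norm_add_powr_le[OF assms(1) l(2,3), of a b] l(1)
        mult_right_mono[of "(1 - l) powr (1 - p)" "1 + e" "norm b powr p"] by simp
  qed simp
qed

text \<open>The one-sided bound is used twice: for \<open>a\<close>, \<open>b\<close> and, to get
  the lower estimate, for \<open>- a\<close>, \<open>a + b\<close>.\<close>

lemma norm_add_powr_diff_le_eps:
  assumes "1 \<le> p" "0 < e"
  obtains C where "0 \<le> C"
    "\<And>a b :: 'a::real_normed_vector.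
       \<bar>norm (a + b) powr p - norm b powr p\<bar> \<le> e * norm b powr p + C * norm a powr p"
proof -
  \<comment> \<open>Inserting the upper estimate into the lower one produces the factor
    \<open>d * (1 + d)\<close>, which is at most \<open>2 * d \<le> e\<close>.\<close>
  define d where "d = min 1 (e / 2)"
  have d: "0 < d" "d \<le> 1" "d * (1 + d) \<le> e" "d \<le> e"
    using assms mult_left_mono[of "1 + d" 2 d] by (auto simp: d_def min_def)
  obtain C where C: "0 \<le> C"
    "\<And>a b :: 'a. norm (a + b) powr p \<le> (1 + d) * norm b powr p + C * norm a powr p"
    using norm_add_powr_le_eps[OF assms(1) d(1)] by metis
  show ?thesis
  proof (rule that[of "(1 + d) * C"])
    show "0 \<le> (1 + d) * C" using C d by simp
    fix a b :: 'a
    let ?A = "norm a powr p" and ?B = "norm b powr p" and ?S = "norm (a + b) powr p"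
    have S: "?S \<le> (1 + d) * ?B + C * ?A" by (rule C)
    have B: "?B \<le> (1 + d) * ?S + C * ?A" using C(2)[of "- a" "a + b"] by simp
    have "d * ?S \<le> d * (1 + d) * ?B + d * C * ?A"
      using mult_left_mono[OF S, of d] d by (simp add: algebra_simps)
    also have "d * (1 + d) * ?B \<le> e * ?B" using d by (intro mult_right_mono) auto
    finally have 1: "?B - ?S \<le> e * ?B + (1 + d) * C * ?A" using B by (simp add: algebra_simps)
    have "d * ?B \<le> e * ?B" "0 \<le> d * C * ?A" using d C by (auto intro: mult_right_mono)
    then have "?S - ?B \<le> e * ?B + (1 + d) * C * ?A" using S by (simp add: algebra_simps)
    with 1 show "\<bar>?S - ?B\<bar> \<le> e * ?B + (1 + d) * C * ?A" by linarith
  qed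
qed

lemma lp_space_add:
  assumes "x \<in> lp_space p" "y \<in> lp_space p" "1 \<le> p"
  shows "(\<lambda>i. x i + y i) \<in> lp_space p"
proof -
  obtain C where C: "0 \<le> C"
    "\<And>a b :: 'a. norm (a + b) powr p \<le> (1 + 1) * norm b powr p + C * norm a powr p"
    using norm_add_powr_le_eps[OF assms(3), of 1] by auto
  have "summable (\<lambda>i. (1 + 1) * norm (y i) powr p + C * norm (x i) powr p)"
    by (intro summable_add summable_mult lp_spaceD assms)
  then have "summable (\<lambda>i. norm (x i + y i) powr p)"
    by (rule summable_comparison_test[rotated]) (use C in auto)
  then show ?thesis by (simp add: lp_space_def)
qed

text \<open>The coordinate defects need not have a common summable bound, but they do once a small
  multiple of \<open>norm (w n i) powr p\<close> is removed, and \<open>B\<close> controls the sum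
  of what was removed.\<close>

lemma lp_modular_add_diff_tendsto:
  fixes x :: "nat \<Rightarrow> 'a::{real_normed_field, heine_borel}"
  assumes p: "1 \<le> p" and x: "x \<in> lp_space p" and w: "\<And>n. w n \<in> lp_space p"
    and B: "\<And>n. lp_modular p (w n) \<le> B"
    and null: "\<And>i. (\<lambda>n. w n i) \<longlonglongrightarrow> 0"
  shows "(\<lambda>n. lp_modular p (\<lambda>i. x i + w n i) - lp_modular p (w n)) \<longlonglongrightarrow> lp_modular p x"
proof (rule LIMSEQ_I)
  fix r :: real assume r: "0 < r"
  have B0: "0 \<le> B" using B[of 0] lp_modular_nonneg[OF w[of 0]] by simp
  \<comment> \<open>The removed part then contributes less than \<open>r / 2\<close>;
    \<open>B + 1\<close> keeps the denominator positive when \<open>B = 0\<close>.\<close>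
  define e where "e = r / (2 * (B + 1))"
  have e: "0 < e" "e * B < r / 2" using r B0 by (auto simp: e_def field_simps)
  obtain C where C: "0 \<le> C" "\<And>a b :: 'a.
      \<bar>norm (a + b) powr p - norm b powr p\<bar> \<le> e * norm b powr p + C * norm a powr p"
    using norm_add_powr_diff_le_eps[OF p e(1)] by metis
  define g where "g n i = norm (x i + w n i) powr p - norm (w n i) powr p - norm (x i) powr p" for n i
  \<comment> \<open>The excess of the defect over the removed part: dominated by a fixed multiple of
    \<open>norm (x i) powr p\<close> and null for each \<open>i\<close>, so Tannery's theorem
    applies.\<close>
  define h where "h n i = max 0 (\<bar>g n i\<bar> - e * norm (w n i) powr p)" for n i
  have xw: "(\<lambda>i. x i + w n i) \<in> lp_space p" for n by (intro lp_space_add x w p)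
  have hle: "norm (h n i) \<le> (C + 1) * norm (x i) powr p" for n i
  proof -
    have "\<bar>g n i\<bar> \<le> \<bar>norm (x i + w n i) powr p - norm (w n i) powr p\<bar> + norm (x i) powr p"
      unfolding g_def using abs_triangle_ineq4 by (metis abs_of_nonneg powr_ge_zero)
    moreover have "0 \<le> C * norm (x i) powr p" using C(1) by simp
    ultimately show ?thesis
      using C(2)[of "x i" "w n i"] by (simp add: h_def distrib_right)
  qed
  have sumM: "summable (\<lambda>i. (C + 1) * norm (x i) powr p)" by (intro summable_mult lp_spaceD x)
  have "(\<lambda>n. h n i) \<longlonglongrightarrow> max 0 (\<bar>norm (x i + 0) powr p - 0 powr p - norm (x i) powr p\<bar> - e * 0 powr p)" for i
    unfolding h_def g_def using p null[of i]
    by (intro tendsto_intros tendsto_powr2 tendsto_norm_zero) (auto intro!: always_eventually)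
  then have "(\<lambda>n. h n i) \<longlonglongrightarrow> 0" for i by simp
  then have "(\<lambda>n. \<Sum>i. h n i) \<longlonglongrightarrow> (\<Sum>i. 0)"
    using tannerys_theorem[of "\<lambda>i n. h n i" "\<lambda>_. 0" sequentially, OF _ _ sumM] hle
    by (simp add: case_prod_unfold)
  then have "eventually (\<lambda>n. (\<Sum>i. h n i) < r / 2) sequentially"
    by (intro order_tendstoD(2)) (use r in auto)
  then obtain N where N: "\<And>n. n \<ge> N \<Longrightarrow> (\<Sum>i. h n i) < r / 2"
    by (auto simp: eventually_sequentially)
  have main: "norm (lp_modular p (\<lambda>i. x i + w n i) - lp_modular p (w n) - lp_modular p x) < r" if "n \<ge> N" for n
  proof -
    have sw: "summable (\<lambda>i. norm (w n i) powr p)" by (intro lp_spaceD w)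
    have sx: "summable (\<lambda>i. norm (x i) powr p)" by (intro lp_spaceD x)
    have sxw: "summable (\<lambda>i. norm (x i + w n i) powr p)" using lp_spaceD[OF xw] .
    have sh: "summable (h n)" using summable_comparison_test[OF _ sumM] hle by blast
    have sr: "summable (\<lambda>i. h n i + e * norm (w n i) powr p)"
      by (intro summable_add summable_mult sh sw)
    have gh: "\<bar>g n i\<bar> \<le> h n i + e * norm (w n i) powr p" for i by (auto simp: h_def)
    have sg: "summable (\<lambda>i. \<bar>g n i\<bar>)"
      by (rule summable_comparison_test[OF _ sr]) (use gh in auto)
    have "lp_modular p (\<lambda>i. x i + w n i) - lp_modular p (w n) - lp_modular p x = (\<Sum>i. g n i)"
      unfolding lp_modular_def g_def using sw sx sxw
      by (simp add: suminf_diff summable_diff)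
    also have "norm \<dots> \<le> (\<Sum>i. \<bar>g n i\<bar>)" using summable_rabs[OF sg] by simp
    also have "\<dots> \<le> (\<Sum>i. h n i + e * norm (w n i) powr p)" by (intro suminf_le gh sg sr)
    also have "\<dots> = (\<Sum>i. h n i) + e * lp_modular p (w n)"
      unfolding lp_modular_def using sh sw by (simp add: suminf_add[symmetric] suminf_mult summable_mult)
    also have "\<dots> < r / 2 + r / 2"
      using N[OF that] mult_left_mono[OF B[of n], of e] e by linarith
    finally show ?thesis by simp
  qed
  then show "\<exists>N. \<forall>n\<ge>N. norm (lp_modular p (\<lambda>i. x i + w n i) - lp_modular p (w n) - lp_modular p x) < r"
    by blast
qed

section \<open>Homogeneous bounds and Pitt's argument\<close>

text \<open>Normalise \<open>x\<close>. The constant \<open>C\<close> makes the supremum finite and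
  settles norm zero, where normalising is impossible. The general \<open>G\<close> serves
  functionals and operators alike.\<close>

lemma le_SUP_lp_sphere:
  fixes G :: "(nat \<Rightarrow> 'a::{real_normed_field, heine_borel}) \<Rightarrow> real"
  assumes p: "0 < p"
    and scale: "\<And>c x. x \<in> lp_space p \<Longrightarrow> G (\<lambda>i. c * x i) = norm c * G x"
    and C: "\<And>x. x \<in> lp_space p \<Longrightarrow> G x \<le> C * lp_norm p x"
    and x: "x \<in> lp_space p"
  shows "G x \<le> (SUP x\<in>{x \<in> lp_space p. lp_norm p x = 1}. G x) * lp_norm p x"
proof (cases "lp_norm p x = 0")
  case True
  then show ?thesis using C[OF x] by simp
next
  case False
  let ?c = "of_real (inverse (lp_norm p x)) :: 'a"
  let ?y = "\<lambda>i. ?c * x i"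
  have pos: "lp_norm p x > 0" using False lp_norm_nonneg[of p x] by simp
  then have nc: "norm ?c = inverse (lp_norm p x)" by (simp add: norm_inverse)
  have y: "?y \<in> lp_space p" "lp_norm p ?y = 1"
    using lp_space_scale[OF x] lp_norm_scale[OF x p] nc False by auto
  have "bdd_above (G ` {x \<in> lp_space p. lp_norm p x = 1})"
    using C by (intro bdd_aboveI2[where M = C]) fastforce
  then have "G ?y \<le> (SUP x\<in>{x \<in> lp_space p. lp_norm p x = 1}. G x)"
    by (rule cSUP_upper[rotated]) (use y in simp)
  then show ?thesis unfolding scale[OF x] nc using pos by (simp add: field_simps)
qed

text \<open>
  Perturbing a near-maximizer \<open>v\<close> of \<open>F\<close> by \<open>t w\<^sub>n\<close> raises the bound \<open>M \<parallel>\<cdot>\<parallel>\<^sup>q\<close> only by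
  order \<open>t powr p\<close>, whereas \<open>F\<close> gains \<open>t powr q * F w\<^sub>n\<close>; divide by \<open>t powr q\<close> and let \<open>t\<close> tend
  to \<open>0\<close>. The phases \<open>c\<close> are needed when \<open>F\<close> is the modulus of a functional (with \<open>q = 1\<close>).
\<close>

lemma pitt_null:
  fixes F :: "(nat \<Rightarrow> 'a::{real_normed_field, heine_borel}) \<Rightarrow> real"
  assumes q: "1 \<le> q" "q < p" and w: "\<And>n. w n \<in> lp_space p"
    and B: "\<And>n. lp_modular p (w n) \<le> B"
    and null: "\<And>i. (\<lambda>n. w n i) \<longlonglongrightarrow> 0"
    and M: "0 \<le> M" and bound: "\<And>x. x \<in> lp_space p \<Longrightarrow> F x \<le> M * lp_modular p x powr (q / p)"
    and near: "\<And>e. 0 < e \<Longrightarrow> \<exists>v\<in>lp_space p. lp_modular p v = 1 \<and> M - e \<le> F v"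
    and nonneg: "\<And>n. 0 \<le> F (w n)"
    and add: "\<And>v t. v \<in> lp_space p \<Longrightarrow> 0 < t \<Longrightarrow> \<exists>c. (\<forall>n. norm (c n) = 1) \<and>
      (\<lambda>n. F (\<lambda>i. v i + of_real t * c n * w n i) - t powr q * F (w n)) \<longlonglongrightarrow> F v"
  shows "(\<lambda>n. F (w n)) \<longlonglongrightarrow> 0"
proof (rule LIMSEQ_I)
  fix r :: real assume r: "0 < r"
  have B0: "0 \<le> B" using B[of 0] lp_modular_nonneg[OF w[of 0]] by simp
  \<comment> \<open>The final estimates give \<open>t powr q * F (w n) < t powr p * K\<close>;
    \<open>t\<close> is chosen so that the right side equals \<open>t powr q * r\<close>.\<close>
  define K where "K = M * (B + 1) + 3"
  have K: "0 < K" using M B0 by (simp add: K_def add_nonneg_pos)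
  define t where "t = (r / K) powr (1 / (p - q))"
  have t: "0 < t" "t powr (p - q) * K = r" using r K q by (auto simp: t_def powr_powr)
  have tp: "0 < t powr p" using t by simp
  obtain v where v: "v \<in> lp_space p" "lp_modular p v = 1" "M - t powr p \<le> F v"
    using near[OF tp] by auto
  obtain c where c: "\<And>n. norm (c n) = 1"
    "(\<lambda>n. F (\<lambda>i. v i + of_real t * c n * w n i) - t powr q * F (w n)) \<longlonglongrightarrow> F v"
    using add[OF v(1) t(1)] by auto
  define z where "z n i = of_real t * c n * w n i" for n i
  have z: "z n \<in> lp_space p" for n unfolding z_def by (intro lp_space_scale w)
  have zmod: "lp_modular p (z n) = t powr p * lp_modular p (w n)" for n
    unfolding z_def using lp_modular_scale[OF w[of n], of "of_real t * c n"] c(1) t(1)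
    by (simp add: norm_mult)
  then have zB: "lp_modular p (z n) \<le> t powr p * B" for n
    using B by (simp add: mult_left_mono)
  have znull: "(\<lambda>n. z n i) \<longlonglongrightarrow> 0" for i
  proof (rule tendsto_norm_zero_cancel)
    have "(\<lambda>n. t * norm (w n i)) \<longlonglongrightarrow> t * 0"
      by (intro tendsto_intros tendsto_norm_zero null)
    then show "(\<lambda>n. norm (z n i)) \<longlonglongrightarrow> 0"
      using t(1) c(1) by (simp add: z_def norm_mult)
  qed
  have "(\<lambda>n. lp_modular p (\<lambda>i. v i + z n i) - lp_modular p (z n)) \<longlonglongrightarrow> 1"
    using lp_modular_add_diff_tendsto[OF _ v(1) z zB znull] q v(2) by simp
  then have "eventually (\<lambda>n. lp_modular p (\<lambda>i. v i + z n i) - lp_modular p (z n) < 1 + t powr p) sequentially"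
    by (rule order_tendstoD) (use tp in simp)
  moreover have "eventually (\<lambda>n. F (\<lambda>i. v i + z n i) - t powr q * F (w n) > F v - t powr p) sequentially"
    using c(2) unfolding z_def by (rule order_tendstoD) (use tp in simp)
  ultimately have "eventually (\<lambda>n. norm (F (w n) - 0) < r) sequentially"
  proof eventually_elim
    case (elim n)
    let ?s = "lp_modular p (\<lambda>i. v i + z n i)"
    have vz: "(\<lambda>i. v i + z n i) \<in> lp_space p" using q by (intro lp_space_add v z) auto
    have s: "0 \<le> ?s" "?s \<le> 1 + t powr p * (B + 1)"
      using lp_modular_nonneg[OF vz] elim(1) zB[of n] by (auto simp: algebra_simps)
    \<comment> \<open>The new base is at least \<open>1\<close> and \<open>q / p < 1\<close>, so the
      exponent may be raised to \<open>1\<close>, leaving an excess of order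
      \<open>t powr p\<close>.\<close>
    have "?s powr (q / p) \<le> (1 + t powr p * (B + 1)) powr (q / p)"
      using s q by (intro powr_mono2) auto
    also have "\<dots> \<le> (1 + t powr p * (B + 1)) powr 1"
      using q B0 by (intro powr_mono) auto
    finally have s': "?s powr (q / p) \<le> 1 + t powr p * (B + 1)" using B0 by simp
    have "t powr q * F (w n) < F (\<lambda>i. v i + z n i) - F v + t powr p" using elim(2) by simp
    also have "\<dots> \<le> M * (1 + t powr p * (B + 1)) - (M - t powr p) + t powr p"
      using order_trans[OF bound[OF vz] mult_left_mono[OF s' M]] v(3) by linarith
    also have "\<dots> \<le> t powr p * K" using tp by (simp add: K_def algebra_simps)
    also have "t powr p * K = t powr q * r"
      unfolding t(2)[symmetric] using t(1) by (simp add: powr_diff)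
    finally have "F (w n) < r" using t(1) by simp
    then show ?case using nonneg[of n] by simp
  qed
  then show "\<exists>N. \<forall>n\<ge>N. norm (F (w n) - 0) < r" by (simp add: eventually_sequentially)
qed

section \<open>Coordinatewise compactness and weak nullity\<close>

text \<open>Tychonoff replaces the diagonal argument: a product of closed balls is compact, and for
  countably many factors it is also sequentially compact.\<close>

lemma bounded_coordinatewise_convergent_subsequence:
  fixes u :: "nat \<Rightarrow> nat \<Rightarrow> 'a::heine_borel"
  assumes "\<And>n i. dist a (u n i) \<le> B"
  obtains r x where "strict_mono (r :: nat \<Rightarrow> nat)" "\<And>i. (\<lambda>n. u (r n) i) \<longlonglongrightarrow> x i"
proof -
  have "compactin (product_topology (\<lambda>_. euclidean) UNIV) (PiE UNIV (\<lambda>_::nat. cball a B))"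
    by (simp add: compactin_PiE)
  then have "compact (PiE UNIV (\<lambda>_::nat. cball a B))"
    by (simp add: euclidean_product_topology)
  then have "seq_compact (PiE UNIV (\<lambda>_::nat. cball a B))"
    by (rule compact_imp_seq_compact)
  moreover have "\<forall>n. u n \<in> PiE UNIV (\<lambda>_::nat. cball a B)" using assms by auto
  ultimately obtain x r where r: "strict_mono (r :: nat \<Rightarrow> nat)" "(u \<circ> r) \<longlonglongrightarrow> x"
    by (auto elim!: seq_compactE)
  have "(\<lambda>n. u (r n) i) \<longlonglongrightarrow> x i" for i
  proof -
    have "isCont (\<lambda>x. x i) x"
      using continuous_on_interior[OF continuous_on_product_coordinates] by simp
    from isCont_tendsto_compose[OF this r(2)] show ?thesis by (simp add: o_def)
  qed
  with r(1) show ?thesis by (rule that)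
qed

lemma unit_vector_lp:
  "(\<lambda>i. if i = 0 then 1 else 0 :: 'a::{real_normed_field, heine_borel}) \<in> lp_space p"
  "lp_norm p (\<lambda>i. if i = 0 then 1 else 0 :: 'a) = 1"
proof -
  have *: "norm ((\<lambda>i. if i = 0 then 1 else 0 :: 'a) i) powr p = (if i = 0 then 1 else 0)" for i :: nat
    by simp
  have "(\<lambda>i::nat. if i = 0 then 1 else 0 :: real) sums 1"
    using sums_single[of 0 "\<lambda>_. 1 :: real"] by simp
  then have "(\<lambda>i. norm ((\<lambda>i. if i = 0 then 1 else 0 :: 'a) i) powr p) sums 1"
    unfolding * .
  then show "(\<lambda>i. if i = 0 then 1 else 0 :: 'a) \<in> lp_space p"
    "lp_norm p (\<lambda>i. if i = 0 then 1 else 0 :: 'a) = 1"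
    unfolding lp_space_def lp_norm_def by (auto simp: sums_iff)
qed

text \<open>Pitt's argument for the modulus of \<open>f\<close>, with target exponent
  \<open>1 < p\<close>, takes the place of a description of the dual space.\<close>

lemma lp_functional_tendsto_zero:
  fixes f :: "(nat \<Rightarrow> 'a::{real_normed_field, heine_borel}) \<Rightarrow> 'a"
  assumes p: "1 < p" and f: "lp_bounded_linear_functional p f"
    and w: "\<And>n. w n \<in> lp_space p" and B: "\<And>n. lp_modular p (w n) \<le> B"
    and null: "\<And>i. (\<lambda>n. w n i) \<longlonglongrightarrow> 0"
  shows "(\<lambda>n. f (w n)) \<longlonglongrightarrow> 0"
proof -
  have f_add: "f (\<lambda>i. x i + y i) = f x + f y" if "x \<in> lp_space p" "y \<in> lp_space p" for x y
    using f that unfolding lp_bounded_linear_functional_def by blast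
  have f_scale: "f (\<lambda>i. c * x i) = c * f x" if "x \<in> lp_space p" for c x
    using f that unfolding lp_bounded_linear_functional_def by blast
  obtain C where C: "\<And>x. x \<in> lp_space p \<Longrightarrow> norm (f x) \<le> C * lp_norm p x"
    using f unfolding lp_bounded_linear_functional_def by blast
  define S where "S = {x \<in> lp_space p :: (nat \<Rightarrow> 'a) set. lp_norm p x = 1}"
  define M where "M = (SUP x\<in>S. norm (f x))"
  have e: "(\<lambda>i. if i = 0 then 1 else 0) \<in> S" by (simp add: S_def unit_vector_lp)
  have bdd: "bdd_above ((\<lambda>x. norm (f x)) ` S)"
    using C by (intro bdd_aboveI2[where M = C]) (fastforce simp: S_def)
  have bound: "norm (f x) \<le> M * lp_norm p x" if "x \<in> lp_space p" for x
    unfolding M_def S_def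
  proof (rule le_SUP_lp_sphere[where C = C])
    show "norm (f (\<lambda>i. c * y i)) = norm c * norm (f y)" if "y \<in> lp_space p" for c y
      unfolding f_scale[OF that] by (rule norm_mult)
  qed (use p C that in auto)
  have "(\<lambda>n. norm (f (w n))) \<longlonglongrightarrow> 0"
  proof (rule pitt_null[where q = 1 and p = p and M = M and B = B and w = w and F = "\<lambda>x. norm (f x)"])
    show "0 \<le> M" unfolding M_def by (rule cSUP_upper2[OF bdd e]) simp
    show "norm (f x) \<le> M * lp_modular p x powr (1 / p)" if "x \<in> lp_space p" for x
      using bound[OF that] by (simp add: lp_norm_modular)
    show "\<exists>v\<in>lp_space p. lp_modular p v = 1 \<and> M - d \<le> norm (f v)" if "0 < d" for d
    proof -
      have "M - d < M" using that by simp
      then obtain v where "v \<in> S" "M - d < norm (f v)"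
        unfolding M_def using less_cSUP_iff[OF _ bdd] e by blast
      then show ?thesis using p by (auto simp: S_def lp_norm_eq_1_iff intro!: bexI[of _ v])
    qed
    fix v :: "nat \<Rightarrow> 'a" and t :: real assume v: "v \<in> lp_space p" and t: "0 < t"
    \<comment> \<open>The phase turns \<open>f (w n)\<close> into the direction of
      \<open>f v\<close>, so that the moduli add up exactly; if either value is \<open>0\<close>,
      any phase does.\<close>
    define c where "c n = (if f v = 0 \<or> f (w n) = 0 then 1
      else f v * of_real (norm (f (w n))) / (f (w n) * of_real (norm (f v))))" for n
    have c1: "norm (c n) = 1" for n by (simp add: c_def norm_mult norm_divide)
    have "norm (f (\<lambda>i. v i + of_real t * c n * w n i)) - t * norm (f (w n)) = norm (f v)" for n
    proof -
      have *: "f (\<lambda>i. v i + of_real t * c n * w n i) = f v + of_real t * c n * f (w n)"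
        using f_add[OF v lp_space_scale[OF w[of n]], of "of_real t * c n"] f_scale[OF w] by simp
      show ?thesis
      proof (cases "f v = 0 \<or> f (w n) = 0")
        case True
        then show ?thesis unfolding * using t c1[of n] by (auto simp: norm_mult)
      next
        case False
        then have eq: "f v + of_real t * c n * f (w n) = f v * of_real (1 + t * norm (f (w n)) / norm (f v))"
          by (simp add: c_def field_simps)
        show ?thesis unfolding * eq norm_mult norm_of_real
          using t False by (simp add: distrib_left)
      qed
    qed
    then show "\<exists>c. (\<forall>n. norm (c n) = 1) \<and>
        (\<lambda>n. norm (f (\<lambda>i. v i + of_real t * c n * w n i)) - t powr 1 * norm (f (w n)))
          \<longlonglongrightarrow> norm (f v)"
      using c1 t by (intro exI[of _ c]) simp
  qed (use p w B null in simp_all)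
  then show ?thesis by (rule tendsto_norm_zero_cancel)
qed

section \<open>Bounded operators on coordinatewise null sequences\<close>

context
  fixes p q :: real and T :: "(nat \<Rightarrow> 'a::{real_normed_field, heine_borel}) \<Rightarrow> (nat \<Rightarrow> 'a)"
  assumes p: "1 < p" and q: "1 \<le> q" and T: "lp_bounded_linear_operator p q T"
begin

lemma lp_operator_in: "x \<in> lp_space p \<Longrightarrow> T x \<in> lp_space q"
  and lp_operator_add: "x \<in> lp_space p \<Longrightarrow> y \<in> lp_space p \<Longrightarrow> T (\<lambda>i. x i + y i) = (\<lambda>i. T x i + T y i)"
  and lp_operator_scale: "x \<in> lp_space p \<Longrightarrow> T (\<lambda>i. c * x i) = (\<lambda>i. c * T x i)"
  using T unfolding lp_bounded_linear_operator_def by blast+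

lemma lp_operator_norm_le:
  assumes "x \<in> lp_space p"
  shows "lp_norm q (T x) \<le> lp_operator_norm p q T * lp_norm p x"
proof -
  obtain C where C: "\<And>x. x \<in> lp_space p \<Longrightarrow> lp_norm q (T x) \<le> C * lp_norm p x"
    using T unfolding lp_bounded_linear_operator_def by blast
  show ?thesis
    unfolding lp_operator_norm_def
  proof (rule le_SUP_lp_sphere[where C = C])
    show "lp_norm q (T (\<lambda>i. c * y i)) = norm c * lp_norm q (T y)" if "y \<in> lp_space p" for c y
      unfolding lp_operator_scale[OF that] using q by (simp add: lp_norm_scale lp_operator_in[OF that])
  qed (use p C assms in auto)
qed

lemma lp_operator_norm_nonneg: "0 \<le> lp_operator_norm p q T"
  using order_trans[OF lp_norm_nonneg lp_operator_norm_le[OF unit_vector_lp(1)]]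
  by (simp add: unit_vector_lp(2))

lemma lp_operator_modular_le:
  assumes "x \<in> lp_space p"
  shows "lp_modular q (T x) \<le> lp_operator_norm p q T powr q * lp_modular p x powr (q / p)"
proof -
  have "lp_modular q (T x) = lp_norm q (T x) powr q"
    using q by (simp add: lp_modular_eq_norm_powr lp_operator_in assms)
  also have "\<dots> \<le> (lp_operator_norm p q T * lp_norm p x) powr q"
    using q lp_operator_norm_le[OF assms] by (intro powr_mono2) (auto simp: lp_norm_nonneg)
  finally show ?thesis by (simp add: powr_mult lp_norm_modular powr_powr)
qed

text \<open>Links weak nullity to the target space: images of bounded coordinatewise null sequences
  are coordinatewise null.\<close>

lemma lp_operator_coordinate_functional: "lp_bounded_linear_functional p (\<lambda>x. T x i)"
proof -
  have "norm (T x i) \<le> lp_operator_norm p q T * lp_norm p x" if "x \<in> lp_space p" for x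
    using q by (intro order_trans[OF norm_le_lp_norm lp_operator_norm_le] lp_operator_in that) auto
  then show ?thesis
    unfolding lp_bounded_linear_functional_def
    by (intro conjI ballI allI exI[of _ "lp_operator_norm p q T"])
      (simp_all only: lp_operator_add lp_operator_scale)
qed

context
  fixes w :: "nat \<Rightarrow> nat \<Rightarrow> 'a" and B :: real
  assumes w: "\<And>n. w n \<in> lp_space p" and B: "\<And>n. lp_modular p (w n) \<le> B"
    and null: "\<And>i. (\<lambda>n. w n i) \<longlonglongrightarrow> 0"
begin

text \<open>The splitting in the target space, where \<open>T (w n)\<close> is again bounded and
  coordinatewise null.\<close>

lemma lp_operator_modular_add_diff_tendsto:
  assumes x: "x \<in> lp_space p"
  shows "(\<lambda>n. lp_modular q (T (\<lambda>i. x i + w n i)) - lp_modular q (T (w n))) \<longlonglongrightarrow> lp_modular q (T x)"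
proof -
  have "lp_modular q (T (w n)) \<le> lp_operator_norm p q T powr q * B powr (q / p)" for n
    using p q by (intro order_trans[OF lp_operator_modular_le[OF w]] mult_left_mono powr_mono2
        lp_modular_nonneg w B) auto
  moreover have "(\<lambda>n. T (w n) i) \<longlonglongrightarrow> 0" for i
    by (rule lp_functional_tendsto_zero[OF p lp_operator_coordinate_functional w B null])
  ultimately show ?thesis
    unfolding lp_operator_add[OF x w]
    by (intro lp_modular_add_diff_tendsto[OF q lp_operator_in[OF x] lp_operator_in[OF w]])
qed

end

text \<open>Pitt's argument: a norm-attaining vector is a near-maximizer for every error, and the
  splitting in the target yields the gain with all phases \<open>1\<close>.\<close>

lemma lp_operator_tendsto_zero:
  assumes qp: "q < p" and att: "lp_attains_norm p q T"
    and w: "\<And>n. w n \<in> lp_space p" and B: "\<And>n. lp_modular p (w n) \<le> B"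
    and null: "\<And>i. (\<lambda>n. w n i) \<longlonglongrightarrow> 0"
  shows "(\<lambda>n. lp_modular q (T (w n))) \<longlonglongrightarrow> 0"
proof (rule pitt_null[where q = q and p = p and M = "lp_operator_norm p q T powr q" and B = B
      and w = w and F = "\<lambda>x. lp_modular q (T x)"])
  obtain v where v: "v \<in> lp_space p" "lp_norm p v = 1" "lp_norm q (T v) = lp_operator_norm p q T"
    using att by (auto simp: lp_attains_norm_def)
  have "lp_modular q (T v) = lp_operator_norm p q T powr q" "lp_modular p v = 1"
    using v p q by (auto simp: lp_modular_eq_norm_powr lp_operator_in)
  then show "\<exists>v\<in>lp_space p. lp_modular p v = 1 \<and> lp_operator_norm p q T powr q - d \<le> lp_modular q (T v)"
    if "0 < d" for d using that v(1) by (intro bexI[of _ v]) auto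
  fix v :: "nat \<Rightarrow> 'a" and t :: real assume v: "v \<in> lp_space p" and t: "0 < t"
  let ?z = "\<lambda>n i. of_real t * w n i"
  have z: "?z n \<in> lp_space p" for n by (rule lp_space_scale[OF w])
  have zB: "lp_modular p (?z n) \<le> t powr p * B" for n
    using t B by (simp add: lp_modular_scale w mult_left_mono)
  have znull: "(\<lambda>n. ?z n i) \<longlonglongrightarrow> 0" for i
    using tendsto_mult[OF tendsto_const null[of i]] by simp
  have "(\<lambda>n. lp_modular q (T (\<lambda>i. v i + of_real t * w n i)) - lp_modular q (T (?z n)))
      \<longlonglongrightarrow> lp_modular q (T v)"
    by (rule lp_operator_modular_add_diff_tendsto[OF z zB znull v])
  then show "\<exists>c. (\<forall>n. norm (c n) = 1) \<and>
      (\<lambda>n. lp_modular q (T (\<lambda>i. v i + of_real t * c n * w n i)) - t powr q * lp_modular q (T (w n)))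
        \<longlonglongrightarrow> lp_modular q (T v)"
    using t by (intro exI[of _ "\<lambda>_. 1"]) (simp add: lp_operator_scale w lp_modular_scale lp_operator_in)
qed (use q qp w B null lp_operator_modular_le lp_modular_nonneg[OF lp_operator_in] in simp_all)

end

section \<open>Coordinatewise limits and the proof of the theorem\<close>

lemma powr_lt_self:
  fixes a s :: real
  assumes "0 < a" "a < 1" "1 < s"
  shows "a powr s < a"
  using powr_less_mono'[of a 1 s] assms by simp

text \<open>Fatou for series: finite partial sums pass to the limit and inherit the bound
  \<open>B\<close>.\<close>

lemma coordinatewise_limit_lp:
  fixes u :: "nat \<Rightarrow> nat \<Rightarrow> 'a::{real_normed_field, heine_borel}"
  assumes p: "0 < p" and u: "\<And>n. u n \<in> lp_space p" "\<And>n. lp_modular p (u n) \<le> B"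
    and lim: "\<And>i. (\<lambda>n. u n i) \<longlonglongrightarrow> x i"
  shows "x \<in> lp_space p"
proof -
  have "(\<Sum>i<m. norm (x i) powr p) \<le> B" for m
  proof (rule LIMSEQ_le_const2)
    show "(\<lambda>n. \<Sum>i<m. norm (u n i) powr p) \<longlonglongrightarrow> (\<Sum>i<m. norm (x i) powr p)"
      using p lim by (intro tendsto_sum tendsto_powr2 tendsto_norm tendsto_const) auto
    have "(\<Sum>i<m. norm (u n i) powr p) \<le> B" for n
      using sum_le_suminf[OF lp_spaceD[OF u(1)], of "{..<m}" n] u(2)[of n] by (simp add: lp_modular_def)
    then show "\<exists>N. \<forall>n\<ge>N. (\<Sum>i<m. norm (u n i) powr p) \<le> B" by blast
  qed
  then show ?thesis
    unfolding lp_space_def by (auto intro!: summableI_nonneg_bounded[where x = B])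
qed

theorem theorem2:
  fixes p q :: real
    and T :: "(nat \<Rightarrow> 'a::{real_normed_field, heine_borel}) \<Rightarrow> (nat \<Rightarrow> 'a)"
    and u :: "nat \<Rightarrow> nat \<Rightarrow> 'a"
  assumes "1 < p" and "1 \<le> q" and "p \<noteq> q"
    and "lp_bounded_linear_operator p q T"
    and "\<exists>x\<in>lp_space p. T x \<noteq> (\<lambda>_. 0)"
    and "lp_attains_norm p q T"
    and "not_weakly_null_maximizing_sequence p q T u"
  shows "\<exists>r x. strict_mono (r :: nat \<Rightarrow> nat) \<and> x \<in> lp_space p \<and>
           lp_converges_in_norm p (\<lambda>k. u (r k)) x"
proof -
  note p = assms(1) and q = assms(2) and T = assms(4)
  define N where "N = lp_operator_norm p q T"
  have u: "\<And>n. u n \<in> lp_space p" "\<And>n. lp_norm p (u n) = 1"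
    and maxi: "(\<lambda>n. lp_norm q (T (u n))) \<longlonglongrightarrow> N"
    and nw: "\<not> lp_converges_weakly p u (\<lambda>_. 0)"
    using assms(7) by (auto simp: not_weakly_null_maximizing_sequence_def N_def)
  have u1: "lp_modular p (u n) = 1" for n
    using u[of n] lp_norm_eq_1_iff[of "u n" p] p by simp
  \<comment> \<open>Allows \<open>N powr q\<close> to be cancelled later; \<open>N = 0\<close> would
    annihilate every coordinate of \<open>T x\<close>.\<close>
  have N_pos: "0 < N"
  proof (rule ccontr)
    assume "\<not> 0 < N"
    then have "N = 0" using lp_operator_norm_nonneg[OF p q T] by (simp add: N_def)
    have "norm (T x i) \<le> 0" if "x \<in> lp_space p" for x i
    proof -
      have "norm (T x i) \<le> lp_norm q (T x)"
        using q by (intro norm_le_lp_norm lp_operator_in[OF p q T that]) auto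
      also have "\<dots> \<le> N * lp_norm p x" unfolding N_def by (rule lp_operator_norm_le[OF p q T that])
      finally show ?thesis using \<open>N = 0\<close> by simp
    qed
    then show False using assms(5) by (auto simp: fun_eq_iff)
  qed
  obtain f where f: "lp_bounded_linear_functional p f" "\<not> (\<lambda>n. f (u n)) \<longlonglongrightarrow> f (\<lambda>_. 0)"
    using nw by (auto simp: lp_converges_weakly_def)
  \<comment> \<open>The zero sequence is written as a multiple of a carrier element, since
    homogeneity is given only there.\<close>
  have "f (\<lambda>i. 0 * u 0 i) = 0 * f (u 0)"
    using f(1) u(1)[of 0] unfolding lp_bounded_linear_functional_def by blast
  then have "\<not> (\<lambda>n. f (u n)) \<longlonglongrightarrow> 0" using f(2) by simp
  then obtain d where d: "0 < d" "\<forall>m. \<exists>n\<ge>m. d \<le> norm (f (u n))"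
    unfolding LIMSEQ_iff by (auto simp: not_less)
  then have "infinite {n. d \<le> norm (f (u n))}"
    unfolding infinite_nat_iff_unbounded_le by auto
  \<comment> \<open>The lower bound \<open>d\<close> holds along all of \<open>r1\<close>, hence
    survives the refinement by \<open>r2\<close>.\<close>
  then obtain r1 :: "nat \<Rightarrow> nat" where r1: "strict_mono r1" "\<And>n. d \<le> norm (f (u (r1 n)))"
    using infinite_enumerate by (metis mem_Collect_eq)
  have "dist 0 (u (r1 n) i) \<le> 1" for n i
    using norm_le_lp_norm[OF u(1), of "r1 n" i] p u(2) by simp
  then obtain r2 x where r2: "strict_mono (r2 :: nat \<Rightarrow> nat)" "\<And>i. (\<lambda>n. u (r1 (r2 n)) i) \<longlonglongrightarrow> x i"
    using bounded_coordinatewise_convergent_subsequence[of 0 "\<lambda>n. u (r1 n)" 1] by blast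
  define r where "r n = r1 (r2 n)" for n
  have r: "strict_mono r" using r1(1) r2(1) by (auto simp: r_def strict_mono_def)
  have lim: "(\<lambda>n. u (r n) i) \<longlonglongrightarrow> x i" for i using r2(2) by (simp add: r_def)
  have x: "x \<in> lp_space p"
    by (rule coordinatewise_limit_lp[OF _ _ _ lim, where B = 1]) (use p u u1 in auto)
  have "\<not> (\<lambda>n. f (u (r n))) \<longlonglongrightarrow> 0"
  proof
    assume "(\<lambda>n. f (u (r n))) \<longlonglongrightarrow> 0"
    then have "(\<lambda>n. norm (f (u (r n)))) \<longlonglongrightarrow> 0" by (rule tendsto_norm_zero)
    then have "d \<le> 0" by (rule LIMSEQ_le_const) (use r1(2) in \<open>auto simp: r_def\<close>)
    with d(1) show False by simp
  qed
  \<comment> \<open>If \<open>x\<close> were zero, \<open>u (r n)\<close> would be bounded and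
    coordinatewise null, forcing \<open>f\<close> to \<open>0\<close> along it.\<close>
  then have "\<not> (\<forall>i. x i = 0)"
    using lp_functional_tendsto_zero[OF p f(1), of "\<lambda>n. u (r n)" 1] u(1) u1 lim by fastforce
  then obtain j where "x j \<noteq> 0" by blast
  define a where "a = lp_modular p x"
  have a_pos: "0 < a"
    using norm_powr_le_lp_modular[OF x, of j] \<open>x j \<noteq> 0\<close>
    by (metis a_def less_le_trans norm_eq_zero powr_gt_zero)
  define w where "w n i = u (r n) i - x i" for n i
  have xw: "(\<lambda>i. x i + w n i) = u (r n)" for n by (simp add: w_def)
  have null: "(\<lambda>n. w n i) \<longlonglongrightarrow> 0" for i
    using tendsto_diff[OF lim[of i] tendsto_const[of "x i"]] by (simp add: w_def)
  have w: "w n \<in> lp_space p" for n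
    using lp_space_add[OF u(1)[of "r n"] lp_space_scale[OF x, of "-1"]] p by (simp add: w_def[abs_def])
  \<comment> \<open>The power inequality with \<open>e = 1\<close>, summed over the coordinates of
    \<open>u (r n) - x\<close>, gives the bound \<open>2 + C * a\<close>.\<close>
  obtain B where B: "lp_modular p (w n) \<le> B" for n
  proof -
    obtain C where C: "0 \<le> C"
      "\<And>a b :: 'a. norm (a + b) powr p \<le> (1 + 1) * norm b powr p + C * norm a powr p"
      using norm_add_powr_le_eps[of p 1] p by (metis less_imp_le zero_less_one)
    have "lp_modular p (w n) \<le> 2 + C * a" for n
    proof -
      have "lp_modular p (w n) \<le> (\<Sum>i. 2 * norm (u (r n) i) powr p + C * norm (x i) powr p)"
        unfolding lp_modular_def using C(2)[of "- x i" "u (r n) i" for i]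
        by (intro suminf_le summable_add summable_mult lp_spaceD w u x) (simp add: w_def)
      also have "\<dots> = 2 * lp_modular p (u (r n)) + C * a"
        unfolding a_def lp_modular_def using lp_spaceD[OF u(1)] lp_spaceD[OF x]
        by (simp add: suminf_add[symmetric] suminf_mult summable_mult)
      finally show ?thesis by (simp add: u1)
    qed
    then show ?thesis by (rule that)
  qed
  have "(\<lambda>n. 1 - lp_modular p (w n)) \<longlonglongrightarrow> a"
    using lp_modular_add_diff_tendsto[OF _ x w B null] p by (simp add: xw u1 a_def)
  from tendsto_diff[OF tendsto_const[of 1] this]
  have wlim: "(\<lambda>n. lp_modular p (w n)) \<longlonglongrightarrow> 1 - a" by simp
  have a_le: "a \<le> 1"
    using LIMSEQ_le_const[OF wlim, of 0] lp_modular_nonneg[OF w] by simp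
  have "(\<lambda>n. lp_norm q (T (u (r n))) powr q) \<longlonglongrightarrow> N powr q"
    using LIMSEQ_subseq_LIMSEQ[OF maxi r] N_pos by (intro tendsto_intros) (auto simp: o_def)
  then have "(\<lambda>n. lp_modular q (T (u (r n)))) \<longlonglongrightarrow> N powr q"
    using q by (simp add: lp_modular_eq_norm_powr lp_operator_in[OF p q T] u)
  moreover have "(\<lambda>n. lp_modular q (T (u (r n))) - lp_modular q (T (w n))) \<longlonglongrightarrow> lp_modular q (T x)"
    using lp_operator_modular_add_diff_tendsto[OF p q T w B null x] by (simp add: xw)
  ultimately have Twlim: "(\<lambda>n. lp_modular q (T (w n))) \<longlonglongrightarrow> N powr q - lp_modular q (T x)"
    using tendsto_diff by fastforce
  have Tx: "lp_modular q (T x) \<le> N powr q * a powr (q / p)"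
    using lp_operator_modular_le[OF p q T x] by (simp add: N_def a_def)
  have "a = 1"
  proof (rule ccontr)
    assume "a \<noteq> 1"
    then have a: "0 < a" "a < 1" using a_pos a_le by auto
    show False
    proof (cases "q < p")
      case True
      \<comment> \<open>The remainder vanishes under \<open>T\<close>, so \<open>x\<close> alone
        would carry all of \<open>N powr q\<close> with modular \<open>a < 1\<close>.\<close>
      have "N powr q = lp_modular q (T x)"
        using LIMSEQ_unique[OF Twlim lp_operator_tendsto_zero[OF p q T True assms(6) w B null]] by simp
      moreover have "N powr q * a powr (q / p) < N powr q * 1"
        using powr_less_mono2[of "q / p" a 1] a p q N_pos by (intro mult_strict_left_mono) auto
      ultimately show False using Tx by simp
    next
      case False
      with assms(3) have "p < q" by simp
      then have "1 < q / p" using p by (simp add: less_divide_eq)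
      then have lt: "a powr (q / p) < a" "(1 - a) powr (q / p) < 1 - a"
        using a powr_lt_self[of a "q / p"] powr_lt_self[of "1 - a" "q / p"] by simp_all
      \<comment> \<open>The remainder has modular tending to \<open>1 - a\<close>; as
        \<open>q / p > 1\<close>, the shares of \<open>x\<close> and of the remainder are together
        too small for \<open>N powr q\<close>.\<close>
      have "N powr q - lp_modular q (T x) \<le> N powr q * (1 - a) powr (q / p)"
      proof (rule LIMSEQ_le[OF Twlim])
        show "(\<lambda>n. N powr q * lp_modular p (w n) powr (q / p)) \<longlonglongrightarrow> N powr q * (1 - a) powr (q / p)"
          using a by (intro tendsto_intros wlim) auto
        show "\<exists>m. \<forall>n\<ge>m. lp_modular q (T (w n)) \<le> N powr q * lp_modular p (w n) powr (q / p)"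
          using lp_operator_modular_le[OF p q T w] by (auto simp: N_def)
      qed
      then have "N powr q * 1 \<le> N powr q * (a powr (q / p) + (1 - a) powr (q / p))"
        using Tx by (simp add: distrib_left)
      then show False using lt N_pos by simp
    qed
  qed
  then have "(\<lambda>n. lp_modular p (w n)) \<longlonglongrightarrow> 0" using wlim by simp
  then have "(\<lambda>n. lp_modular p (w n) powr (1 / p)) \<longlonglongrightarrow> 0 powr (1 / p)"
    using p lp_modular_nonneg[OF w] by (intro tendsto_powr2 tendsto_const) auto
  then have "lp_converges_in_norm p (\<lambda>k. u (r k)) x"
    by (simp add: lp_converges_in_norm_def lp_norm_modular w_def[abs_def])
  with r x show ?thesis by blast
qed

end
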